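(* Let $q,m\in\mathbb N$ and let $\mathcal L=\mathcal L(q;s_1,\dots,s_m)$ and $\mathcal L'=\mathcal L(q;s_1',\dots,s_m')$ be two $q$-congruence lattices in $\mathbb Z^m$. (i) If $k=\alpha q+r\in\mathbb N$ with $\alpha\in\mathbb N_0$ and $0\le r<q$, then for every $0\le\ell\le m$, $$N_{\mathcal L}(k,\ell)=\sum_{s=0}^{m-\ell}2^s\binom{\ell+s}{s}\sum_{t=s}^{\alpha}\binom{t-s+m-\ell-1}{m-\ell-1}\,N^{\mathrm{red}}_{\mathcal L}(k-tq,\ell+s).$$ (ii) $N_{\mathcal L}(k,\ell)=N_{\mathcal L'}(k,\ell)$ for every $k$ and $\ell$ if and only if $N^{\mathrm{red}}_{\mathcal L}(k,\ell)=N^{\mathrm{red}}_{\mathcal L'}(k,\ell)$ for every $k$ and $\ell$.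
   Context: $\mathbb N=\{1,2,\dots\}$, $\mathbb N_0=\mathbb N\cup\{0\}$. For $q\in\mathbb N$ and $s_1,\dots,s_m\in\mathbb Z$ all coprime to $q$, the $q$-congruence lattice is $\mathcal L(q;s_1,\dots,s_m)=\{(a_1,\dots,a_m)\in\mathbb Z^m:\sum_j a_js_j\equiv 0\pmod q\}$. For $\mu=(a_1,\dots,a_m)\in\mathbb Z^m$, $\|\mu\|_1=\sum_j|a_j|$ and $Z(\mu)=\#\{j:a_j=0\}$. For $k\in\mathbb N_0$ and $0\le\ell\le m$, $N_{\mathcal L}(k,\ell)=\#\{\mu\in\mathcal L:\|\mu\|_1=k,\ Z(\mu)=\ell\}$ and $N^{\mathrm{red}}_{\mathcal L}(k,\ell)=\#\{\mu\in C(q)\cap\mathcal L:\|\mu\|_1=k,\ Z(\mu)=\ell\}$, where $C(q)=\{(a_1,\dots,a_m)\in\mathbb Z^m:|a_j|<q\text{ for all }j\}$. Convention for $\ell=m$: $\binom{a}{-1}=0$ for integers $a\ge0$ (the value of $\binom{-1}{-1}$ is irrelevant, as it multiplies $N^{\mathrm{red}}_{\mathcal L}(k,m)=0$ for $k\ge1$). In general $\binom{n+d-1}{d-1}$ counts the ways of writing $n$ as an ordered sum of $d$ nonnegative integers. *)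

theory Defs
  imports "HOL-Analysis.Finite_Cartesian_Product" "HOL-Number_Theory.Cong"
begin

text \<open>Vectors of \<open>\<int>\<^sup>m\<close> have type \<open>int ^ 'm\<close>, so that \<open>m = CARD('m) \<ge> 1\<close>. The requirement that
  every \<open>s $ j\<close> be coprime to \<open>q\<close> is not part of the following definition.\<close>

definition congruence_lattice :: "nat \<Rightarrow> int ^ 'm \<Rightarrow> (int ^ 'm) set" where
  "congruence_lattice q s = {a. [(\<Sum>j\<in>UNIV. a $ j * s $ j) = 0] (mod int q)}"

definition norm1 :: "int ^ 'm \<Rightarrow> int" where
  "norm1 a = (\<Sum>j\<in>UNIV. \<bar>a $ j\<bar>)"

definition zero_count :: "int ^ 'm \<Rightarrow> nat" where
  "zero_count a = card {j. a $ j = 0}"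

definition cube :: "nat \<Rightarrow> (int ^ 'm) set" where
  "cube q = {a. \<forall>j. \<bar>a $ j\<bar> < int q}"

text \<open>The sets counted below are finite because they are bounded in the one-norm.\<close>

definition N :: "(int ^ 'm) set \<Rightarrow> nat \<Rightarrow> nat \<Rightarrow> nat" where
  "N L k l = card {a \<in> L. norm1 a = int k \<and> zero_count a = l}"

definition N_red :: "nat \<Rightarrow> (int ^ 'm) set \<Rightarrow> nat \<Rightarrow> nat \<Rightarrow> nat" where
  "N_red q L k l = card {a \<in> cube q \<inter> L. norm1 a = int k \<and> zero_count a = l}"

text \<open>Binomial coefficient with integer arguments, needed for lower index \<open>-1\<close>: truncated
  subtraction on \<open>nat\<close> would turn that index into \<open>0\<close> and the value into \<open>1\<close>.\<close>

definition int_binomial :: "int \<Rightarrow> int \<Rightarrow> nat" where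
  "int_binomial a b = (if a < 0 \<or> b < 0 then 0 else nat a choose nat b)"

end

theory Submission
  imports Defs
begin

text \<open>Dividing every \<open>\<bar>a $ j\<bar>\<close> by \<open>q\<close> and keeping signs sends a lattice vector \<open>a\<close> to a lattice vector
  \<open>\<nu>\<close> of the cube whose norm is smaller by a multiple \<open>t * q\<close> and which has \<open>i\<close> additional zeros.
  To recover \<open>a\<close> from \<open>\<nu>\<close> one chooses which \<open>i\<close> of the \<open>l + i\<close> zeros of \<open>\<nu>\<close> were nonzero, their signs,
  and the quotients of all nonzero coordinates; the quotients sum to \<open>t\<close> and are at least \<open>1\<close> at the
  \<open>i\<close> chosen places. This gives the first formula. It is triangular in \<open>k\<close> with
  leading term \<open>N_red q L k l\<close>, so the reduced counts can be recovered recursively.\<close>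

section \<open>Functions into the natural numbers with prescribed sum\<close>

text \<open>Enumerating \<open>D\<close> turns functions into lists, for which this is stars and
  bars. With lower index \<open>n\<close> the count is also right for empty \<open>D\<close>,
  despite the truncated \<open>- 1\<close>.\<close>

lemma card_funcset_sum_eq:
  assumes "finite D"
  shows "card {c \<in> D \<rightarrow>\<^sub>E (UNIV :: nat set). sum c D = n} = (n + card D - 1) choose n"
proof -
  obtain xs where xs: "set xs = D" "distinct xs"
    using finite_distinct_list[OF assms] by blast
  have len: "length xs = card D"
    using xs distinct_card by fastforce
  have "bij_betw (\<lambda>c. map c xs) {c \<in> D \<rightarrow>\<^sub>E UNIV. sum c D = n}
          {ys :: nat list. length ys = card D \<and> sum_list ys = n}"
    unfolding bij_betw_def
  proof
    show "inj_on (\<lambda>c. map c xs) {c \<in> D \<rightarrow>\<^sub>E (UNIV :: nat set). sum c D = n}"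
      by (rule inj_onI) (auto simp: xs intro: PiE_ext)
    show "(\<lambda>c. map c xs) ` {c \<in> D \<rightarrow>\<^sub>E UNIV. sum c D = n}
            = {ys :: nat list. length ys = card D \<and> sum_list ys = n}"
    proof (intro equalityI subsetI)
      fix ys assume "ys \<in> (\<lambda>c. map c xs) ` {c \<in> D \<rightarrow>\<^sub>E (UNIV :: nat set). sum c D = n}"
      then show "ys \<in> {ys. length ys = card D \<and> sum_list ys = n}"
        using xs len by (auto simp: sum_list_distinct_conv_sum_set)
    next
      fix ys :: "nat list" assume ys: "ys \<in> {ys. length ys = card D \<and> sum_list ys = n}"
      define c where "c = restrict (\<lambda>x. the (map_of (zip xs ys) x)) D"
      have "map c xs = map (\<lambda>x. the (map_of (zip xs ys) x)) xs"
        using xs by (auto simp: c_def)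
      also have "\<dots> = ys"
        using ys len xs by (auto intro!: nth_equalityI simp: map_of_zip_nth)
      finally have m: "map c xs = ys" .
      then have "sum c D = n"
        using ys xs by (auto simp flip: sum_list_distinct_conv_sum_set)
      then show "ys \<in> (\<lambda>c. map c xs) ` {c \<in> D \<rightarrow>\<^sub>E UNIV. sum c D = n}"
        using m by (auto simp: c_def intro!: image_eqI[where x=c])
    qed
  qed
  then show ?thesis
    using card_length_sum_list by (simp add: bij_betw_same_card)
qed

section \<open>Reduction of coordinates modulo \<open>q\<close>\<close>

text \<open>This is the remainder of division truncated towards zero. Applying \<open>mod\<close> to
  the signed coordinate need not change the one-norm by a multiple of \<open>q\<close>.\<close>

definition reduce :: "nat \<Rightarrow> int ^ 'm \<Rightarrow> int ^ 'm" where
  "reduce q a = (\<chi> j. sgn (a $ j) * (\<bar>a $ j\<bar> mod int q))"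

lemma abs_reduce: "q \<ge> 1 \<Longrightarrow> \<bar>reduce q a $ j\<bar> = \<bar>a $ j\<bar> mod int q"
  by (cases "a $ j = 0") (auto simp: reduce_def abs_mult abs_sgn_eq)

lemma reduce_eq: "a $ j = reduce q a $ j + int q * (sgn (a $ j) * (\<bar>a $ j\<bar> div int q))"
proof -
  have distrib: "e * (u + int q * d) = e * u + int q * (e * d)" for e u d :: int
    by (simp add: algebra_simps)
  have "a $ j = sgn (a $ j) * (\<bar>a $ j\<bar> mod int q + int q * (\<bar>a $ j\<bar> div int q))"
    by (simp only: mod_mult_div_eq sgn_mult_abs)
  then show ?thesis
    by (simp only: distrib reduce_def vec_lambda_beta)
qed

lemma reduce_in_cube: "q \<ge> 1 \<Longrightarrow> reduce q a \<in> cube q"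
  by (simp add: cube_def abs_reduce)

text \<open>Each coordinate changes by a multiple of \<open>q\<close>, so the defining sum keeps its
  residue class.\<close>

lemma reduce_in_lattice_iff:
  "reduce q a \<in> congruence_lattice q s \<longleftrightarrow> a \<in> congruence_lattice q s"
proof -
  have "[(\<Sum>j\<in>UNIV. a $ j * s $ j) = (\<Sum>j\<in>UNIV. reduce q a $ j * s $ j)] (mod int q)"
  proof (intro cong_sum cong_mult cong_refl)
    fix j
    show "[a $ j = reduce q a $ j] (mod int q)"
      by (subst reduce_eq[of _ _ q]) (simp add: cong_def)
  qed
  then show ?thesis
    unfolding congruence_lattice_def by (auto intro: cong_trans cong_sym)
qed

lemma norm1_reduce:
  assumes "q \<ge> 1"
  shows "norm1 a = norm1 (reduce q a) + int q * (\<Sum>j\<in>UNIV. \<bar>a $ j\<bar> div int q)"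
  using assms by (simp add: norm1_def abs_reduce sum_distrib_left flip: sum.distrib)

lemma zero_count_le_reduce: "zero_count a \<le> zero_count (reduce q a)"
  unfolding zero_count_def by (intro card_mono) (auto simp: reduce_def)

text \<open>A vector of one-norm \<open>k\<close> lies in the box with bounds \<open>-k\<close> and
  \<open>k\<close>. The predicates \<open>P\<close> and \<open>Q\<close> let the statement match the
  counted sets.\<close>

lemma finite_norm1: "finite {a :: int ^ 'm. P a \<and> norm1 a = int k \<and> Q a}"
proof (rule finite_subset)
  show "{a :: int ^ 'm. P a \<and> norm1 a = int k \<and> Q a}
          \<subseteq> vec_lambda ` (UNIV \<rightarrow>\<^sub>E {- int k..int k})"
  proof
    fix a :: "int ^ 'm" assume "a \<in> {a. P a \<and> norm1 a = int k \<and> Q a}"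
    then have "\<bar>a $ j\<bar> \<le> int k" for j
      using member_le_sum[of j UNIV "\<lambda>j. \<bar>a $ j\<bar>"] by (simp add: norm1_def)
    then have "vec_nth a \<in> UNIV \<rightarrow>\<^sub>E {- int k..int k}"
      by (auto simp: abs_le_iff) (smt (verit))
    then show "a \<in> vec_lambda ` (UNIV \<rightarrow>\<^sub>E {- int k..int k})"
      by (metis image_eqI vec_nth_inverse)
  qed
qed (intro finite_imageI finite_PiE; simp)

section \<open>Lifting coordinates and the fibres of \<open>reduce\<close>\<close>

text \<open>At a zero of the remainder the quotient is positive and the sign is lost, so the
  sign \<open>p\<close> has to be supplied and \<open>c\<close> is one less than the quotient.\<close>

definition lift_coord :: "nat \<Rightarrow> int \<Rightarrow> bool \<Rightarrow> nat \<Rightarrow> int" where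
  "lift_coord q v p c =
     (if v = 0 then (if p then 1 else -1) * (int q * (int c + 1)) else v + sgn v * (int q * int c))"

text \<open>The added multiple of \<open>q\<close> has the sign of \<open>v\<close>, or the sign
  given by \<open>p\<close> if \<open>v = 0\<close>, so nothing cancels.\<close>

lemma lift_coord:
  assumes "\<bar>v\<bar> < int q"
  shows abs_lift_coord: "\<bar>lift_coord q v p c\<bar> = \<bar>v\<bar> + int q * (int c + of_bool (v = 0))"
    and sgn_lift_coord: "sgn (lift_coord q v p c) = (if v = 0 then if p then 1 else -1 else sgn v)"
proof -
  define y where "y = int q * int c"
  have "y \<ge> 0" "int q > 0" "int q * (int c + 1) = y + int q"
    using assms by (auto simp: y_def algebra_simps)
  then show "\<bar>lift_coord q v p c\<bar> = \<bar>v\<bar> + int q * (int c + of_bool (v = 0))"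
    and "sgn (lift_coord q v p c) = (if v = 0 then if p then 1 else -1 else sgn v)"
    by (auto simp: lift_coord_def sgn_if abs_if simp flip: y_def)
qed

lemma lift_coord_quotient:
  assumes "q \<ge> 1" "x \<noteq> 0" "v = sgn x * (\<bar>x\<bar> mod int q)"
  shows "lift_coord q v (x > 0) (nat (\<bar>x\<bar> div int q) - of_bool (v = 0)) = x"
    and "int (nat (\<bar>x\<bar> div int q) - of_bool (v = 0)) + of_bool (v = 0) = \<bar>x\<bar> div int q"
proof -
  let ?d = "\<bar>x\<bar> div int q"
  have d: "\<bar>x\<bar> = \<bar>x\<bar> mod int q + int q * ?d" "?d \<ge> 0" "\<bar>x\<bar> mod int q \<ge> 0"
    using assms(1) by (auto simp: pos_imp_zdiv_nonneg_iff)
  have v0: "v = 0 \<longleftrightarrow> \<bar>x\<bar> mod int q = 0"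
    using assms by (auto simp: sgn_if)
  \<comment> \<open>A nonzero \<open>x\<close> with remainder 0 has quotient at least 1, so the
    truncated subtraction of \<open>of_bool (v = 0)\<close> is exact.\<close>
  have pos: "?d \<ge> 1" if "v = 0"
    using d that v0 assms(2) by (cases "?d = 0") auto
  show *: "int (nat ?d - of_bool (v = 0)) + of_bool (v = 0) = ?d"
    using pos d(2) by (auto simp: of_nat_diff)
  have sv: "sgn v = sgn x" if "v \<noteq> 0"
    using that v0 d(3) assms(3) by (simp add: sgn_mult)
  have "x = sgn x * (\<bar>x\<bar> mod int q) + sgn x * (int q * ?d)"
    using d(1) by (metis distrib_left mult_sgn_abs)
  then have x: "x = v + sgn x * (int q * ?d)"
    using assms(3) by simp
  show "lift_coord q v (x > 0) (nat ?d - of_bool (v = 0)) = x"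
  proof (cases "v = 0")
    case True
    then show ?thesis
      using x * assms(2) by (auto simp: lift_coord_def sgn_if split: if_splits)
  next
    case False
    then show ?thesis
      using x * sv by (auto simp: lift_coord_def)
  qed
qed

text \<open>The triples consist of the zero set \<open>S\<close> of the lifted vector, the set \<open>P\<close> of positive
  coordinates among the zeros of \<open>\<nu>\<close> outside \<open>S\<close>, and the free part \<open>c\<close> of the quotients.\<close>

lemma card_reduce_fibre:
  fixes \<nu> :: "int ^ 'm"
  assumes "q \<ge> 1" "\<nu> \<in> cube q" "zero_count \<nu> = l + i" "i \<le> t"
  shows "card {a. reduce q a = \<nu> \<and> norm1 a = norm1 \<nu> + int (t * q) \<and> zero_count a = l}
           = ((l + i) choose i) * 2 ^ i * ((t - i + (CARD('m) - l) - 1) choose (t - i))"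
proof -
  define Z where "Z = {j. \<nu> $ j = 0}"
  define T where "T = (SIGMA S:{S. S \<subseteq> Z \<and> card S = l}.
      Pow (Z - S) \<times> {c \<in> (- S) \<rightarrow>\<^sub>E (UNIV :: nat set). sum c (- S) = t - i})"
  define F where "F = {a. reduce q a = \<nu> \<and> norm1 a = norm1 \<nu> + int (t * q) \<and> zero_count a = l}"
  \<comment> \<open>\<open>f\<close> reads the triple off a vector of the fibre, and
    \<open>g\<close> rebuilds the vector from it.\<close>
  define f where "f = (\<lambda>a :: int ^ 'm. ({j. a $ j = 0}, {j. \<nu> $ j = 0 \<and> a $ j > 0},
      \<lambda>j\<in>- {j. a $ j = 0}. nat (\<bar>a $ j\<bar> div int q) - of_bool (\<nu> $ j = 0)))"
  define g where "g = (\<lambda>(S, P, c). (\<chi> j :: 'm. if j \<in> S then 0 else lift_coord q (\<nu> $ j) (j \<in> P) (c j)))"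
  have cardZ: "card Z = l + i"
    using assms(3) by (simp add: Z_def zero_count_def)
  have cube: "\<bar>\<nu> $ j\<bar> < int q" for j
    using assms(2) by (simp add: cube_def)
  \<comment> \<open>At each of the \<open>i\<close> places of \<open>Z - S\<close> the quotient is
    one more than \<open>c\<close>; this is why \<open>T\<close> prescribes the sum
    \<open>t - i\<close>.\<close>
  have sum_Z: "(\<Sum>j\<in>- S. of_bool (\<nu> $ j = 0)) = int i" if "S \<subseteq> Z" "card S = l" for S
  proof -
    have "(\<Sum>j\<in>- S. of_bool (\<nu> $ j = 0)) = (\<Sum>j\<in>Z - S. 1 :: int)"
      by (rule sum.mono_neutral_cong_right) (auto simp: Z_def)
    also have "\<dots> = int i"
      using that cardZ by (simp add: card_Diff_subset)
    finally show ?thesis .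
  qed
  have f_in: "f a \<in> T" and gf: "g (f a) = a" if "a \<in> F" for a
  proof -
    have red: "\<nu> $ j = sgn (a $ j) * (\<bar>a $ j\<bar> mod int q)" for j
      using that by (auto simp: F_def reduce_def)
    note lift = lift_coord_quotient[OF assms(1) _ red]
    show "g (f a) = a"
      unfolding vec_eq_iff
    proof
      fix j
      show "g (f a) $ j = a $ j"
        using lift(1)[of j]
        by (cases "\<nu> $ j = 0") (auto simp: f_def g_def lift_coord_def)
    qed
    let ?S = "{j. a $ j = 0}"
    have S: "?S \<subseteq> Z" "card ?S = l"
      using that red by (auto simp: Z_def F_def zero_count_def)
    let ?c = "\<lambda>j. nat (\<bar>a $ j\<bar> div int q) - of_bool (\<nu> $ j = 0)"
    have "int (sum ?c (- ?S)) + int i = (\<Sum>j\<in>- ?S. int (?c j) + of_bool (\<nu> $ j = 0))"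
      using sum_Z[OF S] by (simp add: sum.distrib)
    also have "\<dots> = (\<Sum>j\<in>- ?S. \<bar>a $ j\<bar> div int q)"
      by (rule sum.cong) (auto simp: lift(2))
    also have "\<dots> = (\<Sum>j\<in>UNIV. \<bar>a $ j\<bar> div int q)"
      by (rule sum.mono_neutral_left) auto
    also have "\<dots> = int t"
      using that norm1_reduce[OF assms(1), of a] assms(1) by (auto simp: F_def)
    finally have "sum ?c (- ?S) = t - i"
      by linarith
    then have "sum (restrict ?c (- ?S)) (- ?S) = t - i"
      by simp
    then show "f a \<in> T"
      using S by (auto simp: T_def f_def Z_def)
  qed
  have g_in: "g x \<in> F" and fg: "f (g x) = x" if "x \<in> T" for x
  proof -
    obtain S P c where x: "x = (S, P, c)"
      by (cases x)
    have S: "S \<subseteq> Z" "card S = l" and P: "P \<subseteq> Z - S"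
      and c: "c \<in> (- S) \<rightarrow>\<^sub>E UNIV" "sum c (- S) = t - i"
      using that by (auto simp: x T_def)
    define a where "a = g x"
    have a: "a $ j = (if j \<in> S then 0 else lift_coord q (\<nu> $ j) (j \<in> P) (c j))" for j
      by (simp add: a_def x g_def)
    have abs_a: "\<bar>a $ j\<bar> = \<bar>\<nu> $ j\<bar> + int q * (int (c j) + of_bool (\<nu> $ j = 0))" if "j \<notin> S" for j
      using that cube by (simp add: a abs_lift_coord)
    have sgn_a: "sgn (a $ j) = (if \<nu> $ j = 0 then if j \<in> P then 1 else -1 else sgn (\<nu> $ j))"
      if "j \<notin> S" for j
      using that cube by (simp add: a sgn_lift_coord)
    have S\<nu>: "\<nu> $ j = 0" if "j \<in> S" for j
      using that S by (auto simp: Z_def)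
    \<comment> \<open>Outside \<open>S\<close> the sign of a lifted coordinate is nonzero, so no
      further zeros arise.\<close>
    have a0: "a $ j = 0 \<longleftrightarrow> j \<in> S" for j
      using sgn_a[of j] a[of j] by (auto simp: sgn_if split: if_splits)
    have zero: "{j. a $ j = 0} = S"
      using a0 by auto
    \<comment> \<open>Since \<open>\<bar>\<nu> $ j\<bar> < int q\<close>, the equation
      \<open>abs_a\<close> is a division with remainder by \<open>q\<close>.\<close>
    have quot: "\<bar>a $ j\<bar> div int q = int (c j) + of_bool (\<nu> $ j = 0)" if "j \<notin> S" for j
      using abs_a[OF that] cube[of j] assms(1) by simp
    have rem: "\<bar>a $ j\<bar> mod int q = \<bar>\<nu> $ j\<bar>" for j
      using abs_a[of j] cube[of j] S\<nu>[of j] a0[of j] by (cases "j \<in> S") auto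
    have red: "reduce q a = \<nu>"
      unfolding vec_eq_iff
    proof
      fix j
      show "reduce q a $ j = \<nu> $ j"
        using S\<nu>[of j] a0[of j] sgn_a[of j]
        by (cases "j \<in> S") (auto simp: reduce_def rem sgn_mult_abs)
    qed
    have "(\<Sum>j\<in>UNIV. \<bar>a $ j\<bar> div int q) = (\<Sum>j\<in>- S. \<bar>a $ j\<bar> div int q)"
      by (rule sum.mono_neutral_right) (simp_all add: a0[THEN iffD2])
    also have "\<dots> = (\<Sum>j\<in>- S. int (c j) + of_bool (\<nu> $ j = 0))"
      by (rule sum.cong) (auto simp: quot)
    also have "\<dots> = int (sum c (- S)) + int i"
      using sum_Z[OF S] by (simp add: sum.distrib)
    also have "\<dots> = int t"
      using c(2) assms(4) by simp
    finally have "norm1 a = norm1 \<nu> + int (t * q)"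
      using norm1_reduce[OF assms(1), of a] red by simp
    then show "g x \<in> F"
      using red zero S by (auto simp: F_def zero_count_def simp flip: a_def)
    have "{j. \<nu> $ j = 0 \<and> a $ j > 0} = P"
    proof -
      have "a $ j > 0 \<longleftrightarrow> j \<in> P" if "\<nu> $ j = 0" for j
        using that sgn_a[of j] a0[of j] P by (cases "j \<in> S") (auto simp: sgn_if split: if_splits)
      then show ?thesis
        using P by (auto simp: Z_def)
    qed
    moreover have "(\<lambda>j\<in>- S. nat (\<bar>a $ j\<bar> div int q) - of_bool (\<nu> $ j = 0)) = c"
    proof (rule extensionalityI[where A = "- S"])
      show "c \<in> extensional (- S)"
        using c(1) by (auto simp: PiE_def)
    qed (auto simp: quot)
    ultimately show "f (g x) = x"
      unfolding a_def[symmetric] by (simp add: f_def zero x)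
  qed
  have "bij_betw f F T"
    using f_in gf g_in fg by (intro bij_betw_byWitness[where f' = g]) auto
  then have "card F = card T"
    by (rule bij_betw_same_card)
  also have "\<dots> = (\<Sum>S | S \<subseteq> Z \<and> card S = l.
      card (Pow (Z - S) \<times> {c \<in> (- S) \<rightarrow>\<^sub>E (UNIV :: nat set). sum c (- S) = t - i}))"
  proof -
    \<comment> \<open>A prescribed sum of natural numbers bounds every summand.\<close>
    have "finite {c \<in> (- S) \<rightarrow>\<^sub>E (UNIV :: nat set). sum c (- S) = t - i}" for S :: "'m set"
    proof (rule finite_subset)
      show "{c \<in> (- S) \<rightarrow>\<^sub>E (UNIV :: nat set). sum c (- S) = t - i} \<subseteq> (- S) \<rightarrow>\<^sub>E {..t - i}"
      proof
        fix c assume c: "c \<in> {c \<in> (- S) \<rightarrow>\<^sub>E (UNIV :: nat set). sum c (- S) = t - i}"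
        then have "c j \<le> t - i" if "j \<in> - S" for j
          using member_le_sum[of j "- S" c] that by auto
        then show "c \<in> (- S) \<rightarrow>\<^sub>E {..t - i}"
          using c by (auto simp: PiE_iff)
      qed
    qed (auto intro: finite_PiE)
    then show ?thesis
      unfolding T_def by (intro card_SigmaI) auto
  qed
  \<comment> \<open>The summand depends on \<open>S\<close> only through its size:
    \<open>Z - S\<close> has \<open>i\<close> elements and \<open>- S\<close> has
    \<open>CARD('m) - l\<close>.\<close>
  also have "\<dots> = (\<Sum>S | S \<subseteq> Z \<and> card S = l. 2 ^ i * ((t - i + (CARD('m) - l) - 1) choose (t - i)))"
  proof (intro sum.cong refl)
    fix S assume "S \<in> {S. S \<subseteq> Z \<and> card S = l}"
    then have S: "S \<subseteq> Z" "card S = l"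
      by auto
    then have "card (Z - S) = i" "card (- S) = CARD('m) - l"
      using cardZ by (auto simp: card_Diff_subset Compl_eq_Diff_UNIV)
    then show "card (Pow (Z - S) \<times> {c \<in> (- S) \<rightarrow>\<^sub>E (UNIV :: nat set). sum c (- S) = t - i})
        = 2 ^ i * ((t - i + (CARD('m) - l) - 1) choose (t - i))"
      by (simp add: card_cartesian_product card_Pow card_funcset_sum_eq)
  qed
  also have "\<dots> = ((l + i) choose l) * (2 ^ i * ((t - i + (CARD('m) - l) - 1) choose (t - i)))"
    by (simp add: n_subsets cardZ)
  also have "(l + i) choose l = (l + i) choose i"
    using binomial_symmetric[of l "l + i"] by simp
  finally show ?thesis
    by (simp add: F_def mult.assoc)
qed

section \<open>The binomial convention and boundary cases\<close>

text \<open>For \<open>l < m\<close> the lower index is nonnegative, and symmetry replaces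
  \<open>m - l - 1\<close> by \<open>t - i\<close>, the form given by the fibre count.\<close>

lemma int_binomial_sub_one:
  assumes "i \<le> t" "l < m"
  shows "int_binomial (int t - int i + int m - int l - 1) (int m - int l - 1)
           = ((t - i + (m - l) - 1) choose (t - i))"
proof -
  have "int t - int i + int m - int l - 1 = int (t - i + (m - l) - 1)"
    and "int m - int l - 1 = int (m - l - 1)"
    using assms by auto
  then have "int_binomial (int t - int i + int m - int l - 1) (int m - int l - 1)
      = ((t - i + (m - l) - 1) choose (m - l - 1))"
    unfolding int_binomial_def by (simp only: nat_int) simp
  also have "\<dots> = ((t - i + (m - l) - 1) choose (t - i))"
    using assms binomial_symmetric[of "t - i" "t - i + (m - l) - 1"] by simp
  finally show ?thesis .
qed

lemma zero_count_le: "zero_count (a :: int ^ 'm) \<le> CARD('m)"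
  unfolding zero_count_def by (rule card_mono) auto

lemma zero_count_eq_full_iff: "zero_count (a :: int ^ 'm) = CARD('m) \<longleftrightarrow> a = 0"
  unfolding zero_count_def
proof
  assume "card {j. a $ j = 0} = CARD('m)"
  then have "{j. a $ j = 0} = UNIV"
    by (intro card_subset_eq) auto
  then show "a = 0"
    by (auto simp: vec_eq_iff)
qed simp

lemma norm1_eq_0_iff: "norm1 a = 0 \<longleftrightarrow> a = 0"
  by (auto simp: norm1_def sum_nonneg_eq_0_iff vec_eq_iff)

text \<open>Only the zero vector has all coordinates zero, and its norm is 0.\<close>

lemma N_full_zero_count: "k \<ge> 1 \<Longrightarrow> N L k CARD('m) = 0" for L :: "(int ^ 'm) set"
  unfolding N_def by (auto simp: zero_count_eq_full_iff norm1_def)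

text \<open>Makes facts about \<open>N\<close> for arbitrary sets of vectors available for the
  reduced counts.\<close>

lemma N_red_eq_N: "N_red q L = N (cube q \<inter> L)"
  by (auto simp: fun_eq_iff N_def N_red_def)

text \<open>Settles norm 0, which the counting formula excludes: the value is the same for every set
  containing the zero vector.\<close>

lemma N_norm_zero:
  fixes L :: "(int ^ 'm) set"
  assumes "0 \<in> L"
  shows "N L 0 l = of_bool (l = CARD('m))"
proof -
  have "{a \<in> L. norm1 a = int 0 \<and> zero_count a = l} = (if l = CARD('m) then {0} else {})"
    using assms zero_count_eq_full_iff[of "0 :: int ^ 'm"] by (auto simp: norm1_eq_0_iff)
  then show ?thesis
    by (simp add: N_def)
qed

lemma zero_in_lattice: "0 \<in> congruence_lattice q s"
  by (simp add: congruence_lattice_def)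

lemma zero_in_cube: "q \<ge> 1 \<Longrightarrow> 0 \<in> cube q"
  by (simp add: cube_def)

section \<open>The counting formula\<close>

text \<open>The vectors are grouped by added zeros \<open>i\<close>, quotient sum \<open>t\<close>
  and reduction \<open>\<nu>\<close>. The fibre size does not depend on the choice of
  \<open>\<nu>\<close> in \<open>R t i\<close>, so these \<open>\<nu>\<close> contribute the factor
  \<open>N_red\<close>.\<close>

lemma N_eq_sum_N_red:
  fixes s :: "int ^ 'm"
  assumes q: "q \<ge> 1" and L: "L = congruence_lattice q s"
    and k: "k \<ge> 1" "k = \<alpha> * q + r" "r < q" and l: "l \<le> CARD('m)"
  shows "N L k l = (\<Sum>i = 0..CARD('m) - l. 2 ^ i * ((l + i) choose i) *
           (\<Sum>t = i..\<alpha>.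
             int_binomial (int t - int i + int CARD('m) - int l - 1) (int CARD('m) - int l - 1)
               * N_red q L (k - t * q) (l + i)))"
proof (cases "l = CARD('m)")
  \<comment> \<open>Here the lower index is \<open>-1\<close>, so the right-hand side vanishes, as
    does the left since \<open>k \<ge> 1\<close>.\<close>
  case True
  then show ?thesis
    using k(1) by (simp add: N_full_zero_count int_binomial_def)
next
  case False
  then have l: "l < CARD('m)"
    using l by simp
  define A where "A = {a \<in> L. norm1 a = int k \<and> zero_count a = l}"
  define R where "R = (\<lambda>t i. {\<nu> \<in> cube q \<inter> L. norm1 \<nu> = int (k - t * q) \<and> zero_count \<nu> = l + i})"
  define T where "T = (SIGMA i:{0..CARD('m) - l}. SIGMA t:{i..\<alpha>}. R t i)"
  define f where "f = (\<lambda>a :: int ^ 'm. (zero_count (reduce q a) - l,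
      nat (\<Sum>j\<in>UNIV. \<bar>a $ j\<bar> div int q), reduce q a))"
  define W where "W = (\<lambda>i t. ((l + i) choose i) * 2 ^ i * ((t - i + (CARD('m) - l) - 1) choose (t - i)))"
  have finA: "finite A"
    unfolding A_def by (rule finite_norm1)
  have finR: "finite (R t i)" for t i
    unfolding R_def by (rule finite_norm1)
  \<comment> \<open>Ensures that the subtraction \<open>k - t * q\<close> is not truncated.\<close>
  have le: "t * q \<le> k" if "t \<le> \<alpha>" for t
    using that k(2) by (simp add: trans_le_add1)
  have f_in: "f a \<in> T" if "a \<in> A" for a
  proof -
    let ?i = "zero_count (reduce q a) - l" and ?d = "\<Sum>j\<in>UNIV. \<bar>a $ j\<bar> div int q"
    define t where "t = nat ?d"
    have d0: "?d \<ge> 0"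
      using q by (intro sum_nonneg) (auto simp: pos_imp_zdiv_nonneg_iff)
    have norm: "norm1 (reduce q a) = int k - int (t * q)"
      using that norm1_reduce[OF q, of a] d0 by (auto simp: A_def t_def mult.commute)
    have "norm1 (reduce q a) \<ge> 0"
      by (simp add: norm1_def sum_nonneg)
    then have tq: "t * q \<le> k"
      using norm by linarith
    then have "t * q < (\<alpha> + 1) * q"
      using k by simp
    then have t: "t \<le> \<alpha>"
      unfolding mult_less_cancel2 by simp
    have zc: "zero_count (reduce q a) = l + ?i"
      using that zero_count_le_reduce[of a q] by (auto simp: A_def)
    \<comment> \<open>At an added zero \<open>\<bar>a $ j\<bar>\<close> is a positive multiple of
      \<open>q\<close>, so its quotient is at least 1. Hence \<open>i \<le> t\<close>, the lower
      limit of the inner sum.\<close>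
    have "?i = card ({j. reduce q a $ j = 0} - {j. a $ j = 0})"
      using that by (subst card_Diff_subset) (auto simp: A_def zero_count_def reduce_def)
    also have "\<dots> = (\<Sum>j\<in>{j. reduce q a $ j = 0} - {j. a $ j = 0}. 1)"
      by simp
    also have "int \<dots> \<le> (\<Sum>j\<in>{j. reduce q a $ j = 0} - {j. a $ j = 0}. \<bar>a $ j\<bar> div int q)"
      unfolding of_nat_sum
    proof (rule sum_mono)
      fix j assume j: "j \<in> {j. reduce q a $ j = 0} - {j. a $ j = 0}"
      then have "\<bar>a $ j\<bar> mod int q = 0"
        using abs_reduce[OF q, of a j] by simp
      then have "int q \<le> \<bar>a $ j\<bar>"
        using j by (intro zdvd_imp_le) auto
      then show "int 1 \<le> \<bar>a $ j\<bar> div int q"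
        using q by (simp add: pos_imp_zdiv_pos_iff int_one_le_iff_zero_less)
    qed
    also have "\<dots> \<le> ?d"
      using q by (intro sum_mono2) (auto simp: pos_imp_zdiv_nonneg_iff)
    finally have it: "?i \<le> t"
      by (simp add: t_def)
    have "reduce q a \<in> R t ?i"
      using that norm tq zc reduce_in_cube[OF q] reduce_in_lattice_iff[of q a s]
      by (auto simp: R_def A_def L of_nat_diff)
    moreover have "?i \<le> CARD('m) - l"
      using zero_count_le[of "reduce q a"] by simp
    ultimately show ?thesis
      using t it by (auto simp: f_def T_def t_def)
  qed
  have fibre: "card {a \<in> A. f a = (i, t, \<nu>)} = W i t" if "(i, t, \<nu>) \<in> T" for i t \<nu>
  proof -
    have it: "i \<le> t" "t \<le> \<alpha>" and \<nu>: "\<nu> \<in> cube q" "\<nu> \<in> L" "norm1 \<nu> = int k - int (t * q)"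
      "zero_count \<nu> = l + i"
      using that le[of t] by (auto simp: T_def R_def of_nat_diff)
    \<comment> \<open>Since \<open>\<nu>\<close> lies in \<open>L\<close>, so does every vector
      reducing to it; and the norm fixes the quotient sum \<open>t\<close>.\<close>
    have "{a \<in> A. f a = (i, t, \<nu>)}
        = {a. reduce q a = \<nu> \<and> norm1 a = norm1 \<nu> + int (t * q) \<and> zero_count a = l}"
    proof (intro equalityI subsetI)
      fix a assume a: "a \<in> {a. reduce q a = \<nu> \<and> norm1 a = norm1 \<nu> + int (t * q) \<and> zero_count a = l}"
      then have "a \<in> A"
        using \<nu> reduce_in_lattice_iff[of q a s] by (auto simp: A_def L)
      moreover have "(\<Sum>j\<in>UNIV. \<bar>a $ j\<bar> div int q) = int t"
        using a norm1_reduce[OF q, of a] q by auto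
      ultimately show "a \<in> {a \<in> A. f a = (i, t, \<nu>)}"
        using a \<nu> by (auto simp: f_def)
    qed (use \<nu> in \<open>auto simp: A_def f_def\<close>)
    then show ?thesis
      using card_reduce_fibre[OF q \<nu>(1) \<nu>(4) it(1)] by (simp add: W_def)
  qed
  have finT: "finite T"
    unfolding T_def using finR by auto
  have "N L k l = card A"
    by (simp add: N_def A_def)
  \<comment> \<open>Each vector of \<open>A\<close> lies over exactly one triple of
    \<open>T\<close>.\<close>
  also have "\<dots> = (\<Sum>x\<in>T. card {a \<in> A. f a = x})"
    using sum.group[OF finA finT image_subsetI[OF f_in], where h = "\<lambda>_. 1 :: nat"] by simp
  also have "\<dots> = (\<Sum>(i, t, \<nu>)\<in>T. W i t)"
    using fibre by (intro sum.cong) auto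
  also have "\<dots> = (\<Sum>i = 0..CARD('m) - l. \<Sum>t = i..\<alpha>. \<Sum>\<nu>\<in>R t i. W i t)"
  proof -
    have inner: "(\<Sum>t = i..\<alpha>. \<Sum>\<nu>\<in>R t i. W i t) = (\<Sum>(t, \<nu>)\<in>(SIGMA t:{i..\<alpha>}. R t i). W i t)" for i
      by (rule sum.Sigma) (use finR in auto)
    show ?thesis
      unfolding T_def inner by (rule sum.Sigma[symmetric]) (use finR in auto)
  qed
  also have "\<dots> = (\<Sum>i = 0..CARD('m) - l. 2 ^ i * ((l + i) choose i) *
           (\<Sum>t = i..\<alpha>.
             int_binomial (int t - int i + int CARD('m) - int l - 1) (int CARD('m) - int l - 1)
               * N_red q L (k - t * q) (l + i)))"
  proof (rule sum.cong[OF refl])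
    fix i
    show "(\<Sum>t = i..\<alpha>. \<Sum>\<nu>\<in>R t i. W i t) = 2 ^ i * ((l + i) choose i) *
           (\<Sum>t = i..\<alpha>.
             int_binomial (int t - int i + int CARD('m) - int l - 1) (int CARD('m) - int l - 1)
               * N_red q L (k - t * q) (l + i))"
      unfolding sum_distrib_left
    proof (rule sum.cong[OF refl])
      fix t assume "t \<in> {i..\<alpha>}"
      then have "int_binomial (int t - int i + int CARD('m) - int l - 1) (int CARD('m) - int l - 1)
           = ((t - i + (CARD('m) - l) - 1) choose (t - i))"
        using l by (intro int_binomial_sub_one) auto
      then show "(\<Sum>\<nu>\<in>R t i. W i t) = 2 ^ i * ((l + i) choose i) *
           (int_binomial (int t - int i + int CARD('m) - int l - 1) (int CARD('m) - int l - 1)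
               * N_red q L (k - t * q) (l + i))"
        by (simp add: W_def N_red_def R_def)
    qed
  qed
  finally show ?thesis .
qed

section \<open>Recovering the reduced counts\<close>

text \<open>The term with \<open>i = t = 0\<close> has coefficient 1 and is split off. The bound
  \<open>max 1 i\<close> removes just this term, as \<open>t = 0\<close> occurs only for
  \<open>i = 0\<close>; all others have norm \<open>k - t * q\<close> below
  \<open>k\<close>.\<close>

lemma N_eq_N_red_plus:
  fixes s :: "int ^ 'm"
  assumes q: "q \<ge> 1" and L: "L = congruence_lattice q s" and k: "k \<ge> 1" and l: "l < CARD('m)"
  shows "N L k l = N_red q L k l + (\<Sum>i = 0..CARD('m) - l. 2 ^ i * ((l + i) choose i) *
           (\<Sum>t = max 1 i..k div q.
             int_binomial (int t - int i + int CARD('m) - int l - 1) (int CARD('m) - int l - 1)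
               * N_red q L (k - t * q) (l + i)))"
proof -
  define h where "h = (\<lambda>i t. int_binomial (int t - int i + int CARD('m) - int l - 1)
      (int CARD('m) - int l - 1) * N_red q L (k - t * q) (l + i))"
  define w where "w = (\<lambda>i. 2 ^ i * ((l + i) choose i))"
  have "h 0 0 = N_red q L k l"
    using int_binomial_sub_one[of 0 0 l "CARD('m)"] l by (simp add: h_def)
  then have split: "(\<Sum>t = 0..k div q. h 0 t) = N_red q L k l + (\<Sum>t = 1..k div q. h 0 t)"
    by (simp add: sum.atLeast_Suc_atMost)
  have "N L k l = (\<Sum>i = 0..CARD('m) - l. w i * (\<Sum>t = i..k div q. h i t))"
    using N_eq_sum_N_red[OF q L k, of "k div q" "k mod q" l] q l by (simp add: h_def w_def)
  also have "\<dots> = (\<Sum>t = 0..k div q. h 0 t)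
      + (\<Sum>i = 1..CARD('m) - l. w i * (\<Sum>t = max 1 i..k div q. h i t))"
    by (simp add: sum.atLeast_Suc_atMost w_def max_def)
  also have "\<dots> = N_red q L k l + (\<Sum>i = 0..CARD('m) - l. w i * (\<Sum>t = max 1 i..k div q. h i t))"
    by (simp add: split sum.atLeast_Suc_atMost[of 0] w_def)
  finally show ?thesis
    by (simp add: h_def w_def)
qed

theorem theorem4p2:
  fixes q :: nat and s s' :: "int ^ 'm" and L L' :: "(int ^ 'm) set"
  assumes "q \<ge> 1"
    and "\<forall>j. coprime (s $ j) (int q)"
    and "\<forall>j. coprime (s' $ j) (int q)"
    and "L = congruence_lattice q s"
    and "L' = congruence_lattice q s'"
  shows "(\<forall>k \<alpha> r l. k \<ge> 1 \<and> k = \<alpha> * q + r \<and> r < q \<and> l \<le> CARD('m) \<longrightarrow>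
           N L k l =
             (\<Sum>i = 0..CARD('m) - l. 2 ^ i * ((l + i) choose i) *
               (\<Sum>t = i..\<alpha>.
                 int_binomial (int t - int i + int CARD('m) - int l - 1)
                              (int CARD('m) - int l - 1)
                 * N_red q L (k - t * q) (l + i))))
       \<and> ((\<forall>k. \<forall>l \<le> CARD('m). N L k l = N L' k l) \<longleftrightarrow>
          (\<forall>k. \<forall>l \<le> CARD('m). N_red q L k l = N_red q L' k l))"
proof (intro conjI iffI)
  show "\<forall>k \<alpha> r l. k \<ge> 1 \<and> k = \<alpha> * q + r \<and> r < q \<and> l \<le> CARD('m) \<longrightarrow>
           N L k l =
             (\<Sum>i = 0..CARD('m) - l. 2 ^ i * ((l + i) choose i) *
               (\<Sum>t = i..\<alpha>.
                 int_binomial (int t - int i + int CARD('m) - int l - 1)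
                              (int CARD('m) - int l - 1)
                 * N_red q L (k - t * q) (l + i)))"
    using N_eq_sum_N_red[OF assms(1,4)] by blast
next
  \<comment> \<open>The formula assumes \<open>k \<ge> 1\<close>. For norm 0 all counts agree
    because both lattices contain the zero vector.\<close>
  have norm_zero: "N L 0 l = N L' 0 l" "N_red q L 0 l = N_red q L' 0 l" for l
    using assms(1,4,5) by (simp_all add: N_red_eq_N N_norm_zero zero_in_lattice zero_in_cube)
  {
    assume red: "\<forall>k. \<forall>l \<le> CARD('m). N_red q L k l = N_red q L' k l"
    show "\<forall>k. \<forall>l \<le> CARD('m). N L k l = N L' k l"
    proof (intro allI impI)
      fix k l assume l: "l \<le> CARD('m)"
      show "N L k l = N L' k l"
      proof (cases "k = 0")
        case False
        then have k: "k \<ge> 1" "k = k div q * q + k mod q" "k mod q < q"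
          using assms(1) by auto
        show ?thesis
          \<comment> \<open>The formula involves only reduced counts, with
            \<open>l + i \<le> CARD('m)\<close>.\<close>
          unfolding N_eq_sum_N_red[OF assms(1,4) k l] N_eq_sum_N_red[OF assms(1,5) k l]
          using red l by (intro sum.cong arg_cong2[where f = "(*)"] refl) auto
      qed (simp add: norm_zero)
    qed
  }
  {
    assume N: "\<forall>k. \<forall>l \<le> CARD('m). N L k l = N L' k l"
    \<comment> \<open>The induction treats all \<open>l\<close> at once, since the remaining terms
      have zero counts \<open>l + i\<close>.\<close>
    have "\<forall>l \<le> CARD('m). N_red q L k l = N_red q L' k l" for k
    proof (induction k rule: less_induct)
      case (less k)
      show ?case
      proof (intro allI impI)
        fix l assume l: "l \<le> CARD('m)"
        consider "k = 0" | "k \<ge> 1" "l = CARD('m)" | "k \<ge> 1" "l < CARD('m)"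
          using l by linarith
        then show "N_red q L k l = N_red q L' k l"
        proof cases
          case 3
          let ?S = "\<lambda>M. \<Sum>i = 0..CARD('m) - l. 2 ^ i * ((l + i) choose i) *
           (\<Sum>t = max 1 i..k div q.
             int_binomial (int t - int i + int CARD('m) - int l - 1) (int CARD('m) - int l - 1)
               * N_red q M (k - t * q) (l + i))"
          \<comment> \<open>As \<open>t\<close>, \<open>q\<close> and \<open>k\<close> are at least
            1, \<open>k - t * q < k\<close> and the induction hypothesis applies.\<close>
          have "?S L = ?S L'"
          proof (intro sum.cong arg_cong2[where f = "(*)"] refl)
            fix i t assume "i \<in> {0..CARD('m) - l}" "t \<in> {max 1 i..k div q}"
            then show "N_red q L (k - t * q) (l + i) = N_red q L' (k - t * q) (l + i)"
              using less.IH[of "k - t * q"] 3 assms(1) by auto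
          qed
          then show ?thesis
            using N_eq_N_red_plus[OF assms(1,4) 3] N_eq_N_red_plus[OF assms(1,5) 3] N l by simp
        next
          case 2
          then show ?thesis
            by (simp add: N_red_eq_N N_full_zero_count)
        qed (simp add: norm_zero)
      qed
    qed
    then show "\<forall>k. \<forall>l \<le> CARD('m). N_red q L k l = N_red q L' k l"
      by blast
  }
qed

end
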